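(* Let $\mathcal{V}$ be a strongly irregular variety of a plural type (possibly containing constant symbols). Then for every splitting pair $(\mathcal{V}_1,\mathcal{V}_2)$ in the lattice $\mathbf{L}(\mathcal{V})$ of subvarieties of $\mathcal{V}$ there exists an equational basis of $\mathcal{V}$ for which the splitting identity of $(\mathcal{V}_1,\mathcal{V}_2)$ is regular; that is, there exist an equational basis $\Gamma$ of $\mathcal{V}$ and a regular identity $\rho\approx\sigma$ such that $\Gamma\cup\{\rho\approx\sigma\}$ is an equational basis of $\mathcal{V}_2$.
   Context: A type is plural if it contains at least one operation symbol of arity at least $2$. An identity $\varphi\approx\psi$ is regular if the same variables occur in $\varphi$ and $\psi$. A variety $\mathcal{V}$ is strongly irregular if there is a binary term $f(x,y)$, in which both $x$ and $y$ actually occur, such that $\mathcal{V}\models f(x,y)\approx x$. A pair $(a,b)$ of elements of a lattice $\mathbf{L}$ is a splitting pair if $a\nleq b$ and for every $c\in L$, $a\le c$ or $c\le b$. For a splitting pair $(\mathcal{V}_1,\mathcal{V}_2)$ in $\mathbf{L}(\mathcal{V})$, a splitting identity is a single identity that axiomatizes $\mathcal{V}_2$ relative to $\mathcal{V}$. An equational basis of a variety is a set of identities axiomatizing it. *)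

theory Defs
  imports "HOL-Algebra.Complete_Lattice" "HOL-Library.FuncSet"
begin

text \<open>
  A type of algebras is an arity function \<open>ar\<close> on a HOL type \<open>'f\<close> of operation symbols; symbols
  of arity 0 are constants. Every nonempty set of symbols, of any cardinality, arises this way.
\<close>

datatype ('f, vars: 'v) tm = Var 'v | Op 'f "('f, 'v) tm list"

type_synonym 'f trm = "('f, nat) tm"
type_synonym 'f ident = "'f trm \<times> 'f trm"

definition plural :: "('f \<Rightarrow> nat) \<Rightarrow> bool" where
  "plural ar \<longleftrightarrow> (\<exists>g. ar g \<ge> 2)"

fun wf_tm :: "('f \<Rightarrow> nat) \<Rightarrow> ('f, 'v) tm \<Rightarrow> bool" where
  "wf_tm ar (Var x) = True"
| "wf_tm ar (Op g ts) = (length ts = ar g \<and> (\<forall>t \<in> set ts. wf_tm ar t))"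

definition identities :: "('f \<Rightarrow> nat) \<Rightarrow> 'f ident set" where
  "identities ar = {(s, t). wf_tm ar s \<and> wf_tm ar t}"

definition regular :: "'f ident \<Rightarrow> bool" where
  "regular e \<longleftrightarrow> vars (fst e) = vars (snd e)"

record ('f, 'u) alg = "'u partial_object" +
  interp :: "'f \<Rightarrow> 'u list \<Rightarrow> 'u"

text \<open>
  Carriers are nonempty subsets of a universe \<open>'u\<close>. Operations are extensional, so that an algebra
  is determined by its carrier and the values of its operations on the carrier.
\<close>

definition algebra :: "('f \<Rightarrow> nat) \<Rightarrow> ('f, 'u) alg \<Rightarrow> bool" where
  "algebra ar A \<longleftrightarrow> carrier A \<noteq> {} \<and>
    (\<forall>g. interp A g \<in> {xs. set xs \<subseteq> carrier A \<and> length xs = ar g} \<rightarrow>\<^sub>E carrier A)"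

fun eval :: "('f, 'u) alg \<Rightarrow> ('v \<Rightarrow> 'u) \<Rightarrow> ('f, 'v) tm \<Rightarrow> 'u" where
  "eval A v (Var x) = v x"
| "eval A v (Op g ts) = interp A g (map (eval A v) ts)"

definition satisfies :: "('f, 'u) alg \<Rightarrow> 'f ident \<Rightarrow> bool"  (infix \<open>\<Turnstile>\<close> 50) where
  "A \<Turnstile> e \<longleftrightarrow> (\<forall>v \<in> UNIV \<rightarrow> carrier A. eval A v (fst e) = eval A v (snd e))"

definition Mod :: "('f \<Rightarrow> nat) \<Rightarrow> 'f ident set \<Rightarrow> ('f, 'u) alg set" where
  "Mod ar \<Sigma> = {A. algebra ar A \<and> (\<forall>e \<in> \<Sigma>. A \<Turnstile> e)}"

definition equational_basis :: "('f \<Rightarrow> nat) \<Rightarrow> 'f ident set \<Rightarrow> ('f, 'u) alg set \<Rightarrow> bool" where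
  "equational_basis ar \<Gamma> V \<longleftrightarrow> \<Gamma> \<subseteq> identities ar \<and> Mod ar \<Gamma> = V"

definition variety :: "('f \<Rightarrow> nat) \<Rightarrow> ('f, 'u) alg set \<Rightarrow> bool" where
  "variety ar V \<longleftrightarrow> (\<exists>\<Gamma>. equational_basis ar \<Gamma> V)"

definition strongly_irregular :: "('f \<Rightarrow> nat) \<Rightarrow> ('f, 'u) alg set \<Rightarrow> bool" where
  "strongly_irregular ar V \<longleftrightarrow>
    (\<exists>f :: 'f trm. wf_tm ar f \<and> vars f = {0, 1} \<and> (\<forall>A \<in> V. A \<Turnstile> (f, Var 0)))"

definition subvariety_lattice :: "('f \<Rightarrow> nat) \<Rightarrow> ('f, 'u) alg set \<Rightarrow> ('f, 'u) alg set gorder" where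
  "subvariety_lattice ar V = \<lparr>carrier = {W. variety ar W \<and> W \<subseteq> V}, eq = (=), le = (\<subseteq>)\<rparr>"

definition splitting_pair :: "('a, 'm) gorder_scheme \<Rightarrow> 'a \<Rightarrow> 'a \<Rightarrow> bool" where
  "splitting_pair L a b \<longleftrightarrow> a \<in> carrier L \<and> b \<in> carrier L \<and> \<not> a \<sqsubseteq>\<^bsub>L\<^esub> b \<and>
    (\<forall>c \<in> carrier L. a \<sqsubseteq>\<^bsub>L\<^esub> c \<or> c \<sqsubseteq>\<^bsub>L\<^esub> b)"

lemma complete_lattice_subvariety_lattice:
  assumes "variety ar V"
  shows "complete_lattice (subvariety_lattice ar V)" (is "complete_lattice ?L")
proof -
  interpret partial_order ?L
    by standard (auto simp: subvariety_lattice_def)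
  show ?thesis
  proof (rule complete_lattice_criterion1)
    show "\<exists>g. greatest ?L g (carrier ?L)"
      using assms by (intro exI[of _ V]) (auto simp: greatest_def subvariety_lattice_def)
  next
    fix \<A> assume \<A>: "\<A> \<subseteq> carrier ?L" "\<A> \<noteq> {}"
    then have "\<forall>W \<in> \<A>. \<exists>\<Gamma>. equational_basis ar \<Gamma> W"
      by (auto simp: subvariety_lattice_def variety_def)
    then obtain G where G: "\<And>W. W \<in> \<A> \<Longrightarrow> equational_basis ar (G W) W"
      by metis
    have "\<Inter>\<A> = Mod ar (\<Union>W\<in>\<A>. G W)"
    proof -
      have "\<Inter>\<A> = (\<Inter>W\<in>\<A>. Mod ar (G W))"
        using G by (force simp: equational_basis_def)
      also have "\<dots> = Mod ar (\<Union>W\<in>\<A>. G W)"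
        using \<A>(2) by (auto simp: Mod_def)
      finally show ?thesis .
    qed
    moreover have "(\<Union>W\<in>\<A>. G W) \<subseteq> identities ar"
      using G by (auto simp: equational_basis_def)
    ultimately have "variety ar (\<Inter>\<A>)"
      unfolding variety_def equational_basis_def by metis
    have carr: "carrier ?L = {W. variety ar W \<and> W \<subseteq> V}"
      and le: "W \<sqsubseteq>\<^bsub>?L\<^esub> X \<longleftrightarrow> W \<subseteq> X" for W X
      by (simp_all add: subvariety_lattice_def)
    have "greatest ?L (\<Inter>\<A>) (Lower ?L \<A>)"
    proof (rule greatest_LowerI)
      show "\<Inter>\<A> \<sqsubseteq>\<^bsub>?L\<^esub> W" if "W \<in> \<A>" for W
        unfolding le using that by (rule Inter_lower)
      show "W \<sqsubseteq>\<^bsub>?L\<^esub> \<Inter>\<A>" if "W \<in> Lower ?L \<A>" for W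
        unfolding le
      proof (rule Inter_greatest)
        show "W \<subseteq> X" if "X \<in> \<A>" for X
          using Lower_memD[OF \<open>W \<in> Lower ?L \<A>\<close> that \<A>(1)] unfolding le by simp
      qed
      show "\<A> \<subseteq> carrier ?L"
        by (rule \<A>(1))
      obtain W where W: "W \<in> \<A>"
        using \<A>(2) by blast
      then have "W \<subseteq> V"
        using \<A>(1) unfolding carr by blast
      then have "\<Inter>\<A> \<subseteq> V"
        using Inter_lower[OF W] by (rule order_trans[rotated])
      then show "\<Inter>\<A> \<in> carrier ?L"
        using \<open>variety ar (\<Inter>\<A>)\<close> unfolding carr by simp
    qed
    then show "\<exists>i. greatest ?L i (Lower ?L \<A>)" ..
  qed
qed

text \<open>
  HOL has no class of all algebras of a given type. Varieties are therefore classes of algebras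
  over a universe \<open>'u\<close>, and the lemma below shows that nothing is lost once \<open>'u\<close> is large enough to
  embed the terms: an identity that follows from \<open>\<Sigma>\<close> in all algebras over \<open>'u\<close> follows from \<open>\<Sigma>\<close> in
  all algebras over any other HOL type.
\<close>

lemma eval_closed:
  assumes "algebra ar A" "v \<in> UNIV \<rightarrow> carrier A" "wf_tm ar t"
  shows "eval A v t \<in> carrier A"
  using assms(3)
proof (induction t)
  case (Op g ts)
  then have "map (eval A v) ts \<in> {xs. set xs \<subseteq> carrier A \<and> length xs = ar g}"
    by auto
  moreover have "interp A g \<in> {xs. set xs \<subseteq> carrier A \<and> length xs = ar g} \<rightarrow>\<^sub>E carrier A"
    using assms(1) by (simp add: algebra_def)
  ultimately have "interp A g (map (eval A v) ts) \<in> carrier A"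
    by (rule PiE_mem[rotated])
  then show ?case
    by simp
qed (use assms(2) in auto)

lemma consequence_universe_independent:
  fixes code :: "'f trm \<Rightarrow> 'u"
  assumes code: "inj code"
    and \<Sigma>: "\<Sigma> \<subseteq> identities ar" and e: "e \<in> identities ar"
    and conseq: "(Mod ar \<Sigma> :: ('f, 'u) alg set) \<subseteq> Mod ar {e}"
  shows "(Mod ar \<Sigma> :: ('f, 'b) alg set) \<subseteq> Mod ar {e}"
proof
  fix B :: "('f, 'b) alg"
  assume B: "B \<in> Mod ar \<Sigma>"
  then have algB: "algebra ar B"
    by (simp add: Mod_def)
  have "eval B v (fst e) = eval B v (snd e)" if v: "v \<in> UNIV \<rightarrow> carrier B" for v
  proof -
    define C where "C = eval B v ` {t :: 'f trm. wf_tm ar t}"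
    define h where "h = code \<circ> inv_into {t :: 'f trm. wf_tm ar t} (eval B v)"
    define k where "k = inv_into C h"
    define A :: "('f, 'u) alg" where
      "A = \<lparr>carrier = h ` C, interp = (\<lambda>g. restrict (\<lambda>xs. h (interp B g (map k xs)))
         {xs. set xs \<subseteq> h ` C \<and> length xs = ar g})\<rparr>"
    have injh: "inj_on h C"
      unfolding h_def C_def
      by (intro comp_inj_on inj_on_inv_into inj_on_subset[OF code]) auto
    have kh: "k (h c) = c" if "c \<in> C" for c
      using that injh by (simp add: k_def)
    have CB: "C \<subseteq> carrier B"
      using eval_closed[OF algB v] by (auto simp: C_def)
    have vC: "v x \<in> C" for x
      unfolding C_def by (rule image_eqI[of _ _ "Var x"]) auto
    have closedC: "interp B g ys \<in> C" if "set ys \<subseteq> C" "length ys = ar g" for g ys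
    proof -
      have "\<forall>y \<in> set ys. \<exists>t :: 'f trm. wf_tm ar t \<and> eval B v t = y"
        using that(1) by (auto simp: C_def)
      then obtain r :: "'b \<Rightarrow> 'f trm"
        where r: "\<And>y. y \<in> set ys \<Longrightarrow> wf_tm ar (r y) \<and> eval B v (r y) = y"
        by metis
      then have "map (eval B v) (map r ys) = ys"
        by (auto intro: map_idI)
      then have "interp B g ys = eval B v (Op g (map r ys))"
        by simp
      moreover have "wf_tm ar (Op g (map r ys))"
        using r that(2) by auto
      ultimately show ?thesis
        unfolding C_def by blast
    qed
    have kC: "set (map k xs) \<subseteq> C" if "set xs \<subseteq> h ` C" for xs
      using that kh by auto
    have algA: "algebra ar A"
      unfolding algebra_def
    proof (intro conjI allI)
      show "carrier A \<noteq> {}"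
        using vC by (auto simp: A_def)
      show "interp A g \<in> {xs. set xs \<subseteq> carrier A \<and> length xs = ar g} \<rightarrow>\<^sub>E carrier A" for g
        using kC closedC by (auto simp: A_def)
    qed
    have evalA: "eval A w t = h (eval B (k \<circ> w) t) \<and> eval B (k \<circ> w) t \<in> C"
      if w: "w \<in> UNIV \<rightarrow> carrier A" and t: "wf_tm ar t" for w :: "nat \<Rightarrow> 'u" and t
      using t
    proof (induction t)
      case (Var x)
      have "w x \<in> h ` C"
        using w by (auto simp: A_def)
      then show ?case
        using kh by auto
    next
      case (Op g ts)
      let ?ys = "map (eval B (k \<circ> w)) ts"
      have IH: "eval A w t = h (eval B (k \<circ> w) t)" "eval B (k \<circ> w) t \<in> C" if "t \<in> set ts" for t
        using Op.IH[OF that] Op.prems that by (simp_all del: comp_apply)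
      have ys: "set ?ys \<subseteq> C" "length ?ys = ar g"
        using IH(2) Op.prems by auto
      have eq: "map (eval A w) ts = map h ?ys"
        using IH(1) by auto
      have "map k (map h ?ys) = ?ys"
        using ys(1) kh by (auto intro!: map_idI simp: subset_iff)
      moreover have "set (map h ?ys) \<subseteq> h ` C"
        using ys(1) by auto
      moreover have "interp A g xs = h (interp B g (map k xs))"
        if "set xs \<subseteq> h ` C" "length xs = ar g" for xs
        using that by (simp add: A_def)
      ultimately have "interp A g (map h ?ys) = h (interp B g ?ys)"
        using ys(2) by (metis length_map)
      then show ?case
        using closedC[OF ys] unfolding eval.simps eq by blast
    qed
    have "A \<Turnstile> d" if d: "d \<in> \<Sigma>" for d
      unfolding satisfies_def
    proof
      fix w :: "nat \<Rightarrow> 'u" assume w: "w \<in> UNIV \<rightarrow> carrier A"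
      have "k \<circ> w \<in> UNIV \<rightarrow> carrier B"
        using evalA[OF w, of "Var _"] CB by fastforce
      moreover have "B \<Turnstile> d"
        using B d by (simp add: Mod_def)
      ultimately have "eval B (k \<circ> w) (fst d) = eval B (k \<circ> w) (snd d)"
        by (simp add: satisfies_def)
      moreover have "wf_tm ar (fst d)" "wf_tm ar (snd d)"
        using d \<Sigma> by (auto simp: identities_def)
      ultimately show "eval A w (fst d) = eval A w (snd d)"
        using evalA[OF w] by simp
    qed
    then have "A \<Turnstile> e"
      using algA conseq by (auto simp: Mod_def)
    moreover have w: "h \<circ> v \<in> UNIV \<rightarrow> carrier A"
      using vC by (auto simp: A_def)
    ultimately have "eval A (h \<circ> v) (fst e) = eval A (h \<circ> v) (snd e)"
      by (simp add: satisfies_def)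
    moreover have "k \<circ> (h \<circ> v) = v"
      using kh vC by auto
    moreover have "wf_tm ar (fst e)" "wf_tm ar (snd e)"
      using e by (auto simp: identities_def)
    ultimately show ?thesis
      using evalA[OF w] injh by (metis inj_onD)
  qed
  then show "B \<in> Mod ar {e}"
    using algB by (simp add: Mod_def satisfies_def)
qed

end

(* In V the term f(s,t) equals s, and f(t,s) equals t, so relative to V the identity s = t amounts
   to the regular identity f(s,t) = f(t,s). The splitting property makes any identity of V2 that
   fails in V1 a splitting identity. *)

theory Submission
  imports Defs
begin

fun subst :: "('v \<Rightarrow> ('f, 'w) tm) \<Rightarrow> ('f, 'v) tm \<Rightarrow> ('f, 'w) tm" where
  "subst \<theta> (Var x) = \<theta> x"
| "subst \<theta> (Op g ts) = Op g (map (subst \<theta>) ts)"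

lemma wf_tm_subst: "wf_tm ar t \<Longrightarrow> (\<And>x. wf_tm ar (\<theta> x)) \<Longrightarrow> wf_tm ar (subst \<theta> t)"
  by (induction t) auto

lemma vars_subst: "vars (subst \<theta> t) = (\<Union>x\<in>vars t. vars (\<theta> x))"
  by (induction t) auto

lemma eval_subst: "eval A v (subst \<theta> t) = eval A (\<lambda>x. eval A v (\<theta> x)) t"
proof (induction t)
  case (Op g ts)
  then have "map (eval A v \<circ> subst \<theta>) ts = map (eval A (\<lambda>x. eval A v (\<theta> x))) ts"
    by simp
  then show ?case
    by (simp only: subst.simps eval.simps map_map)
qed simp

text \<open>This is $f(s,t)$ for a binary term \<open>f\<close> in the variables 0 and 1. Sending
  every index other than 0 to \<open>t\<close> keeps the substitution total, so well-formedness
  needs no condition on \<open>vars f\<close>.\<close>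

definition subst2 :: "'f trm \<Rightarrow> ('f, 'v) tm \<Rightarrow> ('f, 'v) tm \<Rightarrow> ('f, 'v) tm" where
  "subst2 f s t = subst (\<lambda>i. if i = 0 then s else t) f"

lemma wf_tm_subst2: "wf_tm ar f \<Longrightarrow> wf_tm ar s \<Longrightarrow> wf_tm ar t \<Longrightarrow> wf_tm ar (subst2 f s t)"
  by (simp add: subst2_def wf_tm_subst)

text \<open>Both variables really occur in \<open>f\<close>, so no variable of \<open>s\<close> or
  \<open>t\<close> is lost. The result is symmetric in \<open>s\<close> and \<open>t\<close>, which
  is the source of regularity.\<close>

lemma vars_subst2: "vars f = {0, 1} \<Longrightarrow> vars (subst2 f s t) = vars s \<union> vars t"
  by (simp add: subst2_def vars_subst)

lemma eval_subst2_projection: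
  assumes A: "algebra ar A" and f: "A \<Turnstile> (f, Var 0)"
    and v: "v \<in> UNIV \<rightarrow> carrier A" and st: "wf_tm ar s" "wf_tm ar t"
  shows "eval A v (subst2 f s t) = eval A v s"
proof -
  \<comment> \<open>Substituting into \<open>f\<close> amounts to evaluating \<open>f\<close> at
    this assignment. It stays in the carrier because \<open>s\<close> and \<open>t\<close> are
    well-formed, so the identity for \<open>f\<close> applies to it.\<close>
  let ?w = "\<lambda>i::nat. eval A v (if i = 0 then s else t)"
  have "?w \<in> UNIV \<rightarrow> carrier A"
    using eval_closed[OF A v] st by auto
  then have "eval A ?w f = eval A ?w (Var 0)"
    using f unfolding satisfies_def by (metis fst_conv snd_conv)
  then show ?thesis
    by (simp add: subst2_def eval_subst)
qed

text \<open>Under each assignment both compound terms collapse to their first arguments,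
  \<open>s\<close> and \<open>t\<close>.\<close>

lemma satisfies_subst2_iff:
  assumes "algebra ar A" "A \<Turnstile> (f, Var 0)" "wf_tm ar s" "wf_tm ar t"
  shows "A \<Turnstile> (subst2 f s t, subst2 f t s) \<longleftrightarrow> A \<Turnstile> (s, t)"
  unfolding satisfies_def fst_conv snd_conv
  by (intro ball_cong refl) (simp only: eval_subst2_projection[OF assms(1,2)] assms(3,4))

lemma Mod_Un: "Mod ar (\<Gamma> \<union> \<Delta>) = Mod ar \<Gamma> \<inter> Mod ar \<Delta>"
  by (auto simp: Mod_def)

text \<open>An identity \<open>e\<close> of \<open>V2\<close> that fails in \<open>V1\<close> cuts
  out of \<open>V\<close> a subvariety not above \<open>V1\<close>; by splitting it lies below
  \<open>V2\<close>. It contains \<open>V2\<close> since \<open>e\<close> holds there. The basis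
  \<open>\<Gamma>\<close> of \<open>V\<close> is arbitrary.\<close>

lemma splitting_identity_exists:
  assumes V: "equational_basis ar \<Gamma> V"
    and split: "splitting_pair (subvariety_lattice ar V) V1 V2"
  obtains e where "e \<in> identities ar" "equational_basis ar (\<Gamma> \<union> {e}) V2"
proof -
  have V1: "V1 \<subseteq> V" "\<not> V1 \<subseteq> V2" and V2: "variety ar V2" "V2 \<subseteq> V"
    and dich: "\<And>W. variety ar W \<Longrightarrow> W \<subseteq> V \<Longrightarrow> V1 \<subseteq> W \<or> W \<subseteq> V2"
    using split by (auto simp: splitting_pair_def subvariety_lattice_def)
  obtain \<Delta> where \<Delta>: "\<Delta> \<subseteq> identities ar" "Mod ar \<Delta> = V2"
    using V2(1) by (auto simp: variety_def equational_basis_def)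
  \<comment> \<open>A member \<open>A\<close> of \<open>V1\<close> outside \<open>V2\<close> is
    still an algebra, being in \<open>V\<close>, so it can miss \<open>V2\<close> only by violating
    some identity of \<open>\<Delta>\<close>.\<close>
  obtain A e where Ae: "A \<in> V1" "e \<in> \<Delta>" "\<not> A \<Turnstile> e"
    using V1 V \<Delta>(2) by (fastforce simp: equational_basis_def Mod_def)
  let ?W = "Mod ar (\<Gamma> \<union> {e})"
  have basis: "equational_basis ar (\<Gamma> \<union> {e}) ?W"
    using V \<Delta>(1) Ae(2) by (auto simp: equational_basis_def)
  have "?W \<subseteq> V"
    using V unfolding equational_basis_def Mod_Un by blast
  moreover have "\<not> V1 \<subseteq> ?W"
    using Ae by (auto simp: Mod_def)
  ultimately have "?W \<subseteq> V2"
    using dich[of ?W] basis by (auto simp: variety_def)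
  moreover have "V2 \<subseteq> ?W"
    using V V2(2) \<Delta>(2) Ae(2) by (auto simp: equational_basis_def Mod_def)
  ultimately have "?W = V2"
    by (rule equalityI)
  with basis \<Delta>(1) Ae(2) show thesis
    by (intro that) auto
qed

theorem theorem7:
  fixes ar :: "'f \<Rightarrow> nat"
    and V V1 V2 :: "('f, 'u) alg set"
    and code :: "'f trm \<Rightarrow> 'u"
  assumes large_universe: "inj code"
    and "plural ar"
    and "variety ar V"
    and "strongly_irregular ar V"
    and "splitting_pair (subvariety_lattice ar V) V1 V2"
  shows "\<exists>\<Gamma> \<rho> \<sigma>. equational_basis ar \<Gamma> V \<and> (\<rho>, \<sigma>) \<in> identities ar \<and> regular (\<rho>, \<sigma>) \<and>
    equational_basis ar (\<Gamma> \<union> {(\<rho>, \<sigma>)}) V2"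
proof -
  \<comment> \<open>Any basis of \<open>V\<close> will do: it is kept fixed, and only the splitting
    identity is replaced.\<close>
  obtain \<Gamma> where \<Gamma>: "equational_basis ar \<Gamma> V"
    using assms(3) by (auto simp: variety_def)
  obtain f :: "'f trm" where f: "wf_tm ar f" "vars f = {0, 1}" "\<And>A. A \<in> V \<Longrightarrow> A \<Turnstile> (f, Var 0)"
    using assms(4) by (auto simp: strongly_irregular_def)
  obtain s t where st: "(s, t) \<in> identities ar" "equational_basis ar (\<Gamma> \<union> {(s, t)}) V2"
    using splitting_identity_exists[OF \<Gamma> assms(5)] by (metis surj_pair)
  let ?\<rho> = "subst2 f s t" and ?\<sigma> = "subst2 f t s"
  have wf: "wf_tm ar s" "wf_tm ar t"
    using st(1) by (auto simp: identities_def)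
  have \<rho>\<sigma>: "(?\<rho>, ?\<sigma>) \<in> identities ar"
    using f(1) wf by (simp add: identities_def wf_tm_subst2)
  have V: "Mod ar \<Gamma> = V"
    using \<Gamma> by (simp add: equational_basis_def)
  \<comment> \<open>The equivalence is claimed only inside \<open>V\<close>, where \<open>f\<close>
    is a projection. This suffices, since \<open>\<Gamma>\<close> confines both model classes to
    \<open>V\<close>.\<close>
  have "A \<Turnstile> (?\<rho>, ?\<sigma>) \<longleftrightarrow> A \<Turnstile> (s, t)" if "A \<in> V" for A
    using satisfies_subst2_iff[OF _ f(3)[OF that] wf] that V by (auto simp: Mod_def)
  then have "(Mod ar (\<Gamma> \<union> {(?\<rho>, ?\<sigma>)}) :: ('f, 'u) alg set) = Mod ar (\<Gamma> \<union> {(s, t)})"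
    unfolding Mod_Un V by (auto simp: Mod_def)
  then have "equational_basis ar (\<Gamma> \<union> {(?\<rho>, ?\<sigma>)}) V2"
    using st(2) \<rho>\<sigma> by (simp add: equational_basis_def)
  moreover have "regular (?\<rho>, ?\<sigma>)"
    by (simp add: regular_def vars_subst2[OF f(2)] Un_commute)
  ultimately show ?thesis
    using \<Gamma> \<rho>\<sigma> by blast
qed

end
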